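(* The cost of (symmetric) Zassenhaus splittings for the semiclassical time-dependent Schrödinger equation grows quadratically in the order desired.
   Context: Setting. The equation is $\partial_t u=\mathrm{i}\varepsilon\partial_x^2u-\mathrm{i}\varepsilon^{-1}V u$ on $[-1,1]$ with periodic boundary conditions, $0<\varepsilon\ll1$, $V$ a smooth real periodic function; the time step is scaled as $t=\mathcal{O}(\varepsilon^\sigma)$ for some $\sigma>0$. For a smooth periodic function $f$, $\langle f\rangle_k=\tfrac12(M_f\circ\partial_x^k+\partial_x^k\circ M_f)$, where $M_f$ is multiplication by $f$; so $\langle 1\rangle_2=\partial_x^2$ and $\langle V\rangle_0=M_V$. The splitting. The order desired is measured by $n$: the symmetric Zassenhaus splitting with error $\mathcal{O}(\varepsilon^{(2n+3)\sigma-1})$ has the form $$e^{\mathrm{i}t(\varepsilon\langle1\rangle_2-\varepsilon^{-1}\langle V\rangle_0)}=e^{\frac12W^{[0]}}\cdots e^{\frac12W^{[n]}}e^{W^{[n+1]}}e^{\frac12W^{[n]}}\cdots e^{\frac12W^{[0]}}+\mathcal{O}(\varepsilon^{(2n+3)\sigma-1}),$$ where $W^{[0]}=\mathrm{i}t\varepsilon\langle1\rangle_2$, $W^{[1]}=-\mathrm{i}t\varepsilon^{-1}\langle V\rangle_0$, and for $k\ge2$ the exponent $W^{[k]}$ arises from grade $2k-1$ commutators (nested commutators in $2k-1$ letters) of $\mathrm{i}t\varepsilon\langle1\rangle_2$ and $-\mathrm{i}t\varepsilon^{-1}\langle V\rangle_0$, written without commutators as a sum of terms of the form $\langle f_0\rangle_0,\langle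 f_2\rangle_2,\dots,\langle f_{2k-2}\rangle_{2k-2}$; it is of size $\mathcal{O}(\varepsilon^{(2k-1)\sigma-1})$. Cost. The cost is the cost per time step, which is dominated by Fast Fourier Transforms (FFTs). Space is discretised pseudospectrally with $M=\mathcal{O}(\varepsilon^{-1})$ grid points, $\partial_x$ being replaced by a circulant differentiation matrix and $M_f$ by a diagonal matrix, so each FFT costs $\mathcal{O}(\varepsilon^{-1}\log\varepsilon^{-1})$. The exponential of (a multiple of) $W^{[0]}$ uses two FFTs, that of $W^{[1]}$ is the exponential of a diagonal matrix, and the exponential of $W^{[k]}$, $k\ge2$, is approximated by $\left\lceil\frac{(2n+3)\sigma-1}{(2k-1)\sigma-1}\right\rceil$ Lanczos iterations, each requiring a product of $W^{[k]}$ with a vector; the product of $\langle f\rangle_0$ with a vector is pointwise and that of $\langle f\rangle_j$, $j\ge1$, uses four FFTs. *)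

theory Defs
  imports "HOL-Analysis.Analysis" "HOL-Library.Landau_Symbols"
begin

text \<open>Functions on \<open>[-1,1]\<close> with periodic boundary conditions are 2-periodic functions on the
  real line.\<close>

type_synonym operator = "(real \<Rightarrow> complex) \<Rightarrow> (real \<Rightarrow> complex)"

definition deriv_op :: operator where
  "deriv_op u = (\<lambda>x. vector_derivative u (at x))"

definition smooth_periodic :: "(real \<Rightarrow> complex) \<Rightarrow> bool" where
  "smooth_periodic u \<longleftrightarrow>
     (\<forall>x. u (x + 2) = u x) \<and> (\<forall>k x. ((deriv_op ^^ k) u) differentiable (at x))"

definition symmetrised :: "(real \<Rightarrow> complex) \<Rightarrow> nat \<Rightarrow> operator" where
  "symmetrised f k u =
     (\<lambda>x. (f x * (deriv_op ^^ k) u x + (deriv_op ^^ k) (\<lambda>y. f y * u y) x) / 2)"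

definition commutator :: "operator \<Rightarrow> operator \<Rightarrow> operator" where
  "commutator X Y u = (\<lambda>x. X (Y u) x - Y (X u) x)"

inductive nested_commutator :: "operator \<Rightarrow> operator \<Rightarrow> nat \<Rightarrow> operator \<Rightarrow> bool"
  for A B where
  "nested_commutator A B 1 A"
| "nested_commutator A B 1 B"
| "nested_commutator A B m X \<Longrightarrow> nested_commutator A B l Y \<Longrightarrow>
     nested_commutator A B (m + l) (commutator X Y)"

text \<open>An exponent is kept in its commutator-free form, because the cost depends on how it is written
  and not only on the operator it denotes: the list of all \<open>(j, f)\<close> stands for the sum of the
  operators \<open>symmetrised f j\<close>. The powers of the time step \<open>t\<close> are split off: the exponent with index
  \<open>k\<close> is \<open>t ^ grade k\<close> times the operator of the list \<open>W k\<close>.\<close>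

type_synonym exponent = "(nat \<times> (real \<Rightarrow> complex)) list"

definition exponent_op :: "exponent \<Rightarrow> operator" where
  "exponent_op w u = (\<lambda>x. \<Sum>(j, f)\<leftarrow>w. symmetrised f j u x)"

definition grade :: "nat \<Rightarrow> nat" where
  "grade k = (if k = 0 then 1 else 2 * k - 1)"

definition kinetic :: "real \<Rightarrow> exponent" where
  "kinetic \<epsilon> = [(2, \<lambda>_. \<i> * of_real \<epsilon>)]"

definition potential :: "(real \<Rightarrow> real) \<Rightarrow> real \<Rightarrow> exponent" where
  "potential V \<epsilon> = [(0, \<lambda>x. - \<i> * of_real (V x / \<epsilon>))]"

text \<open>The factors of the splitting from left to right; \<open>(c, k)\<close> stands for the exponential of \<open>c\<close>
  times the exponent with index \<open>k\<close>.\<close>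

definition stages :: "nat \<Rightarrow> (real \<times> nat) list" where
  "stages n = map (\<lambda>k. (1/2, k)) [0..<n + 1] @ [(1, n + 1)] @ rev (map (\<lambda>k. (1/2, k)) [0..<n + 1])"

text \<open>Differential operators do not have a norm-convergent exponential series, so the order of the
  splitting is expressed by formal power series in \<open>t\<close>, each given by its operator-valued
  coefficients.\<close>

definition series_one :: "nat \<Rightarrow> operator" where
  "series_one m u = (\<lambda>x. if m = 0 then u x else 0)"

definition series_mult :: "(nat \<Rightarrow> operator) \<Rightarrow> (nat \<Rightarrow> operator) \<Rightarrow> nat \<Rightarrow> operator" where
  "series_mult P Q m u = (\<lambda>x. \<Sum>i\<le>m. P i (Q (m - i) u) x)"

text \<open>The series of \<open>exp (c * t ^ d * A)\<close>.\<close>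

definition exp_series :: "real \<Rightarrow> nat \<Rightarrow> operator \<Rightarrow> nat \<Rightarrow> operator" where
  "exp_series c d A m u =
     (\<lambda>x. if d dvd m then of_real (c ^ (m div d) / fact (m div d)) * (A ^^ (m div d)) u x else 0)"

definition splitting_series :: "(nat \<Rightarrow> exponent) \<Rightarrow> nat \<Rightarrow> nat \<Rightarrow> operator" where
  "splitting_series W n =
     foldr (\<lambda>(c, k). series_mult (exp_series c (grade k) (exponent_op (W k)))) (stages n) series_one"

definition symmetric_zassenhaus ::
    "(real \<Rightarrow> real) \<Rightarrow> real \<Rightarrow> nat \<Rightarrow> (nat \<Rightarrow> exponent) \<Rightarrow> bool" where
  "symmetric_zassenhaus V \<epsilon> n W \<longleftrightarrow>
     W 0 = kinetic \<epsilon> \<and> W 1 = potential V \<epsilon> \<and>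
     (\<forall>k\<in>{2..n + 1}.
        map fst (W k) = map (\<lambda>i. 2 * i) [0..<k] \<and>
        (\<forall>(j, f)\<in>set (W k). smooth_periodic f) \<and>
        (\<exists>cs :: (real \<times> operator) list.
           (\<forall>(c, X)\<in>set cs.
              nested_commutator (exponent_op (W 0)) (exponent_op (W 1)) (2 * k - 1) X) \<and>
           (\<forall>u x. smooth_periodic u \<longrightarrow>
              exponent_op (W k) u x = (\<Sum>(c, X)\<leftarrow>cs. of_real c * X u x)))) \<and>
     (\<forall>m < 2 * n + 3. \<forall>u x. smooth_periodic u \<longrightarrow>
        splitting_series W n m u x =
        exp_series 1 1 (exponent_op (W 0 @ W 1)) m u x)"

text \<open>The size of the exponent with index \<open>k\<close> is \<open>O(\<epsilon> powr ((2 * k - 1) * \<sigma> - 1))\<close>, where each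
  derivative counts as a factor \<open>1 / \<epsilon>\<close>, the scale of the differentiation matrix
  on \<open>O(1 / \<epsilon>)\<close> grid points.\<close>

definition exponent_size ::
    "real \<Rightarrow> (real \<Rightarrow> real) \<Rightarrow> (real \<Rightarrow> nat \<Rightarrow> exponent) \<Rightarrow> nat \<Rightarrow> bool" where
  "exponent_size \<sigma> \<tau> W k \<longleftrightarrow>
     (\<forall>i<k. \<exists>C. \<forall>\<^sub>F \<epsilon> in at_right 0. \<forall>x.
        norm (of_real (\<tau> \<epsilon> ^ (2 * k - 1)) * snd (W \<epsilon> k ! i) x) * (1 / \<epsilon>) ^ (2 * i)
          \<le> C * \<epsilon> powr ((2 * real k - 1) * \<sigma> - 1))"

text \<open>After discretisation the multiplication by \<open>f\<close> is a diagonal matrix and the \<open>j\<close>-th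
  derivative (\<open>j > 0\<close>) a circulant matrix, applied with one FFT and one inverse FFT;
  \<open>symmetrised f j\<close> contains two such derivatives.\<close>

definition product_ffts :: "nat \<Rightarrow> nat" where
  "product_ffts j = (if j = 0 then 0 else 4)"

text \<open>The quotient is meaningful if \<open>(2 * k - 1) * \<sigma> > 1\<close>, which holds for all \<open>k \<ge> 2\<close>
  if \<open>\<sigma> > 1/3\<close>. For smaller \<open>\<sigma>\<close> it fails for finitely many \<open>k\<close>, where a non-positive quotient (or
  a zero denominator) is counted as no iteration.\<close>

definition lanczos_iterations :: "real \<Rightarrow> nat \<Rightarrow> nat \<Rightarrow> nat" where
  "lanczos_iterations \<sigma> n k =
     nat \<lceil>((2 * real n + 3) * \<sigma> - 1) / ((2 * real k - 1) * \<sigma> - 1)\<rceil>"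

text \<open>The exponential of the circulant kinetic part (\<open>k = 0\<close>) is diagonalised by the FFT, that of the
  potential (\<open>k = 1\<close>) is diagonal; all others are approximated by Lanczos iterations with one
  matrix-vector product each.\<close>

definition exponential_ffts :: "real \<Rightarrow> nat \<Rightarrow> (nat \<Rightarrow> exponent) \<Rightarrow> nat \<Rightarrow> nat" where
  "exponential_ffts \<sigma> n W k =
     (if k = 0 then 2
      else if k = 1 then 0
      else lanczos_iterations \<sigma> n k * (\<Sum>(j, f)\<leftarrow>W k. product_ffts j))"

text \<open>The cost of a time step is the cost of all its FFTs, where \<open>\<phi>\<close> is the cost of one FFT.\<close>

definition step_cost :: "real \<Rightarrow> nat \<Rightarrow> (nat \<Rightarrow> exponent) \<Rightarrow> real \<Rightarrow> real" where
  "step_cost \<sigma> n W \<phi> = real (\<Sum>(c, k)\<leftarrow>stages n. exponential_ffts \<sigma> n W k) * \<phi>"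

end

theory Submission
  imports Defs
begin

text \<open>The exponent with index \<open>k \<ge> 2\<close> has one summand for each even order below \<open>2 * k\<close>, so a product with it
  needs \<open>4 * (k - 1)\<close> FFTs, while its exponential takes about \<open>n / k\<close> Lanczos iterations. Hence every
  exponential needs \<open>O(n)\<close> FFTs and the step \<open>O(n\<^sup>2)\<close>. Conversely, all but finitely many of the
  exponentials need at least one iteration, so the step needs at least
  \<open>4 * (\<Sum>j\<le>n. j) - O(1)\<close> FFTs.\<close>

section \<open>Exact FFT count of a time step\<close>

lemma sum_list_stages:
  fixes e :: "nat \<Rightarrow> nat"
  shows "(\<Sum>(c, k)\<leftarrow>stages n. e k) = 2 * (\<Sum>k\<le>n. e k) + e (n + 1)"
proof -
  have "(\<Sum>k\<leftarrow>[0..<n + 1]. e k) = (\<Sum>k\<le>n. e k)"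
    by (simp add: interv_sum_list_conv_sum_set_nat atLeast0LessThan lessThan_Suc_atMost del: upt_Suc)
  then show ?thesis
    by (simp add: stages_def rev_map[symmetric] o_def del: upt_Suc)
qed

lemma sum_product_ffts:
  assumes "map fst w = map (\<lambda>i. 2 * i) [0..<k]"
  shows "(\<Sum>(j, f)\<leftarrow>w. product_ffts j) = 4 * (k - 1)"
proof -
  have "(\<Sum>(j, f)\<leftarrow>w. product_ffts j) = sum_list (map product_ffts (map fst w))"
    by (simp add: o_def case_prod_unfold)
  also have "\<dots> = (\<Sum>i\<leftarrow>[0..<k]. product_ffts (2 * i))"
    unfolding assms by (simp add: o_def)
  also have "\<dots> = 4 * (k - 1)"
    \<comment> \<open>Only the summand of order 0 is free of FFTs. At \<open>k = 0\<close> the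
      truncated \<open>k - 1\<close> agrees with the empty sum.\<close>
    by (induction k) (auto simp: product_ffts_def)
  finally show ?thesis .
qed

text \<open>With the shift \<open>j = k - 1\<close> the product count of index \<open>k\<close>
  becomes \<open>4 * j\<close>. Each outer exponential occurs twice and the central one once, whence
  the factors 8 and 4; the constant 4 comes from the two kinetic exponentials at the ends.\<close>

lemma step_cost_symmetric_zassenhaus:
  assumes "symmetric_zassenhaus V \<epsilon> n W"
  shows "step_cost \<sigma> n W \<phi> =
    real (4 + 8 * (\<Sum>j<n. j * lanczos_iterations \<sigma> n (j + 1))
            + 4 * (n * lanczos_iterations \<sigma> n (n + 1))) * \<phi>"
proof -
  define e where "e = exponential_ffts \<sigma> n W"
  have e: "e (Suc j) = 4 * (j * lanczos_iterations \<sigma> n (j + 1))" if "j \<le> n" for j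
  \<comment> \<open>At \<open>j = 0\<close> the index is 1, the potential: its exponential needs no
    FFT, and the factor \<open>j\<close> gives 0 whatever the iteration count.\<close>
  proof (cases "j = 0")
    case False
    then have "map fst (W (Suc j)) = map (\<lambda>i. 2 * i) [0..<Suc j]"
      using assms that unfolding symmetric_zassenhaus_def by auto
    from sum_product_ffts[OF this] False show ?thesis
      by (simp add: e_def exponential_ffts_def)
  qed (simp add: e_def exponential_ffts_def)
  have "(\<Sum>k\<le>n. e k) = e 0 + (\<Sum>j<n. e (Suc j))"
    by (simp only: lessThan_Suc_atMost[symmetric] sum.lessThan_Suc_shift)
  also have "(\<Sum>j<n. e (Suc j)) = 4 * (\<Sum>j<n. j * lanczos_iterations \<sigma> n (j + 1))"
    unfolding sum_distrib_left by (intro sum.cong) (auto simp: e)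
  finally have "(\<Sum>k\<le>n. e k) = 2 + 4 * (\<Sum>j<n. j * lanczos_iterations \<sigma> n (j + 1))"
    by (simp add: e_def exponential_ffts_def)
  then show ?thesis
    using e[of n] by (simp add: step_cost_def sum_list_stages e_def)
qed

section \<open>Bounds on the Lanczos iterations\<close>

text \<open>For \<open>k \<le> n + 1\<close> the numerator of the quotient dominates its positive
  denominator, so the ceiling is at least 1. This drives the lower bound on the cost.\<close>

lemma lanczos_iterations_pos:
  assumes "\<sigma> > 0" "(2 * real k - 1) * \<sigma> > 1" "k \<le> n + 1"
  shows "lanczos_iterations \<sigma> n k \<ge> 1"
proof -
  have "(2 * real k - 1) * \<sigma> \<le> (2 * real n + 3) * \<sigma>"
    using assms by (intro mult_right_mono) auto
  then have "((2 * real n + 3) * \<sigma> - 1) / ((2 * real k - 1) * \<sigma> - 1) > 0"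
    using assms by (intro divide_pos_pos) linarith+
  then show ?thesis
    by (simp add: lanczos_iterations_def Suc_le_eq)
qed

text \<open>The iteration counts of the finitely many indices below \<open>1 / \<sigma>\<close>, where a positive denominator
  may be close to zero, are absorbed into the constant.\<close>

lemma index_times_lanczos_iterations_le:
  assumes "\<sigma> > 0"
  obtains D where "D > 0"
    "\<And>n j. 1 \<le> n \<Longrightarrow> j \<le> n \<Longrightarrow> real (j * lanczos_iterations \<sigma> n (j + 1)) \<le> D * real n"
proof -
  \<comment> \<open>\<open>d j\<close> is the denominator of the iteration quotient for the index
    \<open>j + 1\<close>.\<close>
  define d where "d j = (2 * real j + 1) * \<sigma> - 1" for j
  define S where "S = {j. real j < 1 / \<sigma>}"
  have "S \<subseteq> {..nat \<lceil>1 / \<sigma>\<rceil>}"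
    unfolding S_def by (auto simp: le_nat_iff) linarith
  then have "finite S"
    by (rule finite_subset) simp
  \<comment> \<open>Outside \<open>S\<close>, \<open>j * \<sigma> \<ge> 1\<close> forces
    \<open>d j \<ge> j * \<sigma>\<close>, so \<open>1 / \<sigma>\<close> bounds the quotient;
    inside \<open>S\<close> the finite sum does. Absolute values keep the terms with negative
    \<open>d j\<close> harmless.\<close>
  define B where "B = 1 / \<sigma> + (\<Sum>j\<in>S. \<bar>real j / d j\<bar>)"
  have "B > 0"
    unfolding B_def using assms by (intro add_pos_nonneg sum_nonneg) auto
  have B: "real j / d j \<le> B" if "d j > 0" for j
  proof (cases "j \<in> S")
    case True
    then have "\<bar>real j / d j\<bar> \<le> (\<Sum>j\<in>S. \<bar>real j / d j\<bar>)"
      using \<open>finite S\<close> by (intro member_le_sum) auto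
    moreover have "1 / \<sigma> > 0"
      using assms by simp
    ultimately show ?thesis
      unfolding B_def by linarith
  next
    case False
    then have "1 \<le> real j * \<sigma>"
      using assms by (simp add: S_def not_less divide_simps split: if_splits)
    then have "real j * \<sigma> \<le> d j"
      using assms by (simp add: d_def algebra_simps)
    then have "real j / d j \<le> 1 / \<sigma>"
      using assms that by (simp add: divide_simps mult.commute)
    moreover have "(\<Sum>j\<in>S. \<bar>real j / d j\<bar>) \<ge> 0"
      by (intro sum_nonneg) auto
    ultimately show ?thesis
      unfolding B_def by linarith
  qed
  \<comment> \<open>The 5 comes from \<open>2 * n + 3 \<le> 5 * n\<close> for
    \<open>n \<ge> 1\<close>; the summand 1 pays for rounding up, which adds at most
    \<open>j \<le> n\<close>.\<close>
  have bound: "real (j * lanczos_iterations \<sigma> n (j + 1)) \<le> (5 * \<sigma> * B + 1) * real n"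
    if n: "1 \<le> n" and j: "j \<le> n" for n j
  proof -
    define N where "N = (2 * real n + 3) * \<sigma> - 1"
    have L: "lanczos_iterations \<sigma> n (j + 1) = nat \<lceil>N / d j\<rceil>"
      by (simp add: lanczos_iterations_def N_def d_def algebra_simps)
    have dN: "d j \<le> N"
      using assms j by (auto simp: N_def d_def intro!: mult_right_mono)
    have N: "N \<le> 5 * \<sigma> * real n"
    proof -
      have "(2 * real n + 3) * \<sigma> \<le> (5 * real n) * \<sigma>"
        using assms n by (intro mult_right_mono) auto
      then show ?thesis
        by (simp add: N_def algebra_simps)
    qed
    have pos: "0 \<le> 5 * \<sigma> * B * real n"
      using assms \<open>B > 0\<close> by simp
    show ?thesis
    proof (cases "d j > 0")
      case True
      with dN have "real (nat \<lceil>N / d j\<rceil>) \<le> N / d j + 1"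
        by simp
      then have "real (j * nat \<lceil>N / d j\<rceil>) \<le> real j * (N / d j + 1)"
        by (simp add: mult_left_mono)
      also have "\<dots> = N * (real j / d j) + real j"
        by (simp add: algebra_simps)
      also have "\<dots> \<le> 5 * \<sigma> * real n * B + real n"
        using N B[OF True] j True dN assms by (intro add_mono mult_mono) auto
      finally show ?thesis
        unfolding L by (simp add: algebra_simps)
    next
      case False
      \<comment> \<open>Dividing \<open>d j \<le> N\<close> by a negative \<open>d j\<close>
        reverses the inequality; for \<open>d j = 0\<close> the quotient is 0 by convention.\<close>
      have "N / d j \<le> 1"
        using False dN by (cases "d j = 0") (auto simp: divide_simps)
      then have "nat \<lceil>N / d j\<rceil> \<le> 1"
        by (simp add: ceiling_le_iff)
      then have "j * nat \<lceil>N / d j\<rceil> \<le> n * 1"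
        using j by (intro mult_mono) auto
      then have "real (j * nat \<lceil>N / d j\<rceil>) \<le> real n"
        by (simp only: of_nat_le_iff mult_1_right)
      with pos show ?thesis
        unfolding L by (simp add: algebra_simps)
    qed
  qed
  show ?thesis
    using assms \<open>B > 0\<close> by (intro that[of "5 * \<sigma> * B + 1"] bound) (auto intro: add_pos_pos)
qed

section \<open>Quadratic bounds on the cost\<close>

text \<open>The exact count depends on \<open>\<sigma>\<close> and \<open>n\<close> alone, so the
  constants can be fixed before the potential, \<open>\<epsilon>\<close>, the exponents and the FFT
  cost. This gives the uniformity in \<open>\<epsilon>\<close> needed later.\<close>

lemma step_cost_quadratic_bounds:
  assumes "\<sigma> > 0"
  obtains c C where "c > 0" "C > 0"
    "\<And>V \<epsilon> n W \<phi>. 1 \<le> n \<Longrightarrow> symmetric_zassenhaus V \<epsilon> n W \<Longrightarrow> 0 \<le> \<phi> \<Longrightarrow>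
       c * real n ^ 2 * \<phi> \<le> step_cost \<sigma> n W \<phi> \<and> step_cost \<sigma> n W \<phi> \<le> C * real n ^ 2 * \<phi>"
proof -
  define a where "a n j = j * lanczos_iterations \<sigma> n (j + 1)" for n j
  define F where "F n = real (4 + 8 * (\<Sum>j<n. a n j) + 4 * a n n)" for n
  obtain D where "D > 0" and D: "\<And>n j. 1 \<le> n \<Longrightarrow> j \<le> n \<Longrightarrow> real (a n j) \<le> D * real n"
    using index_times_lanczos_iterations_le[OF assms] unfolding a_def by metis
  \<comment> \<open>From \<open>j = K\<close> on,
    \<open>(2 * j + 1) * \<sigma> \<ge> K * \<sigma> > 1\<close>, so at least one iteration takes
    place.\<close>
  obtain K where K: "1 / \<sigma> < real K"
    using reals_Archimedean2 by blast
  have iterate: "j \<le> a n j" if "K \<le> j" "j \<le> n" for n j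
  proof -
    have "1 < real K * \<sigma>"
      using K assms by (simp add: divide_simps)
    also have "\<dots> \<le> (2 * real (j + 1) - 1) * \<sigma>"
      using that assms by (intro mult_right_mono) auto
    finally have "lanczos_iterations \<sigma> n (j + 1) \<ge> 1"
      using assms that by (intro lanczos_iterations_pos) auto
    then show ?thesis
      by (simp add: a_def)
  qed
  have lower: "2 / (1 + real K ^ 2) * real n ^ 2 \<le> F n" for n
  proof -
    have "n ^ 2 \<le> 2 * (\<Sum>j\<le>n. j)"
      by (induction n) (auto simp: power2_eq_square)
    \<comment> \<open>The indices below \<open>K\<close> may have no iteration at all; their share
      is restored by a correction of at most \<open>K ^ 2\<close>.\<close>
    also have "(\<Sum>j\<le>n. j) \<le> (\<Sum>j\<le>n. a n j + (if j < K then j else 0))"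
      using iterate by (intro sum_mono) (auto simp: not_less intro: trans_le_add1)
    also have "\<dots> = (\<Sum>j\<le>n. a n j) + (\<Sum>j\<in>{..n} \<inter> {..<K}. j)"
      by (simp add: sum.distrib sum.inter_restrict)
    also have "(\<Sum>j\<in>{..n} \<inter> {..<K}. j) \<le> (\<Sum>j<K. j)"
      by (intro sum_mono2) auto
    also have "(\<Sum>j<K. j) \<le> K ^ 2"
      by (induction K) (auto simp: power2_eq_square)
    finally have "n ^ 2 \<le> 2 * ((\<Sum>j\<le>n. a n j) + K ^ 2)"
      by simp
    then have "real (n ^ 2) \<le> real (2 * ((\<Sum>j\<le>n. a n j) + K ^ 2))"
      by (simp only: of_nat_le_iff)
    then have "real n ^ 2 \<le> 2 * (real (\<Sum>j\<le>n. a n j) + real K ^ 2)"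
      by (simp del: of_nat_sum)
    moreover have "4 + 4 * real (\<Sum>j\<le>n. a n j) \<le> F n"
      by (simp add: F_def lessThan_Suc_atMost[symmetric] sum_nonneg del: of_nat_sum)
    \<comment> \<open>The correction is absorbed multiplicatively, using \<open>F n \<ge> 4\<close>;
      hence \<open>1 + K ^ 2\<close> in the constant.\<close>
    moreover have "4 * real K ^ 2 \<le> F n * real K ^ 2"
      unfolding F_def by (intro mult_right_mono) (auto intro!: add_nonneg_nonneg sum_nonneg)
    ultimately have "2 * real n ^ 2 \<le> F n * (1 + real K ^ 2)"
      by (simp add: algebra_simps)
    then show ?thesis
      by (simp add: divide_simps add_pos_nonneg)
  qed
  \<comment> \<open>12 is the sum of the weights 8 and 4 in \<open>F\<close>; the additive 4 is
    covered by \<open>1 \<le> n ^ 2\<close>.\<close>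
  have upper: "F n \<le> (4 + 12 * D) * real n ^ 2" if "1 \<le> n" for n
  proof -
    have "(\<Sum>j<n. real (a n j)) \<le> (\<Sum>j<n. D * real n)"
      using D that by (intro sum_mono) auto
    then have "(\<Sum>j<n. real (a n j)) \<le> D * real n ^ 2"
      by (simp add: power2_eq_square algebra_simps)
    moreover have "real (a n n) \<le> D * real n ^ 2"
    proof -
      have "D * real n \<le> D * real n ^ 2"
        using that \<open>D > 0\<close> by (simp add: power2_eq_square)
      with D[of n n] that show ?thesis
        by simp
    qed
    moreover have "1 \<le> real n ^ 2"
      using that by simp
    ultimately show ?thesis
      by (simp add: F_def algebra_simps)
  qed
  show ?thesis
  proof (rule that)
    show "2 / (1 + real K ^ 2) > 0"
      by (simp add: add_pos_nonneg)
    show "4 + 12 * D > 0"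
      using \<open>D > 0\<close> by simp
    fix V \<epsilon> n W and \<phi> :: real
    assume *: "1 \<le> n" "symmetric_zassenhaus V \<epsilon> n W" "0 \<le> \<phi>"
    have cost: "step_cost \<sigma> n W \<phi> = F n * \<phi>"
      using step_cost_symmetric_zassenhaus[OF *(2)] by (simp add: F_def a_def)
    show "2 / (1 + real K ^ 2) * real n ^ 2 * \<phi> \<le> step_cost \<sigma> n W \<phi> \<and>
          step_cost \<sigma> n W \<phi> \<le> (4 + 12 * D) * real n ^ 2 * \<phi>"
      unfolding cost by (intro conjI mult_right_mono lower upper *)
  qed
qed

text \<open>The two-sided bound with constants depending only on \<open>\<sigma>\<close> yields
  everything: fixing \<open>\<epsilon>\<close> gives the order of growth in \<open>n\<close>, and
  inserting the cost of one FFT gives the last bound.\<close>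

theorem theorem9:
  fixes V :: "real \<Rightarrow> real" and \<sigma> :: real and \<tau> :: "real \<Rightarrow> real" and \<phi> :: "real \<Rightarrow> real"
    and W :: "nat \<Rightarrow> real \<Rightarrow> nat \<Rightarrow> exponent"
  assumes "smooth_periodic (\<lambda>x. complex_of_real (V x))"
    and "\<sigma> > 0"
    and "\<And>\<epsilon>. 0 < \<epsilon> \<Longrightarrow> \<epsilon> < 1 \<Longrightarrow> \<tau> \<epsilon> > 0"
    and "\<tau> \<in> O[at_right 0](\<lambda>\<epsilon>. \<epsilon> powr \<sigma>)"
    and "\<And>n \<epsilon>. 0 < \<epsilon> \<Longrightarrow> \<epsilon> < 1 \<Longrightarrow> symmetric_zassenhaus V \<epsilon> n (W n \<epsilon>)"
    and "\<And>n k. 2 \<le> k \<Longrightarrow> k \<le> n + 1 \<Longrightarrow> exponent_size \<sigma> \<tau> (W n) k"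
    and "\<And>\<epsilon>. 0 < \<epsilon> \<Longrightarrow> \<epsilon> < 1 \<Longrightarrow> \<phi> \<epsilon> > 0"
    and "\<phi> \<in> O[at_right 0](\<lambda>\<epsilon>. (1 / \<epsilon>) * ln (1 / \<epsilon>))"
  shows "(\<forall>\<epsilon>. 0 < \<epsilon> \<and> \<epsilon> < 1 \<longrightarrow>
           (\<lambda>n. step_cost \<sigma> n (W n \<epsilon>) (\<phi> \<epsilon>)) \<in> \<Theta>(\<lambda>n. real n ^ 2)) \<and>
         (\<exists>c > 0. \<exists>C > 0. \<forall>n \<ge> 1. \<forall>\<epsilon>. 0 < \<epsilon> \<and> \<epsilon> < 1 \<longrightarrow>
           c * real n ^ 2 * \<phi> \<epsilon> \<le> step_cost \<sigma> n (W n \<epsilon>) (\<phi> \<epsilon>) \<and>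
           step_cost \<sigma> n (W n \<epsilon>) (\<phi> \<epsilon>) \<le> C * real n ^ 2 * \<phi> \<epsilon>) \<and>
         (\<exists>C > 0. \<forall>\<^sub>F \<epsilon> in at_right 0. \<forall>n \<ge> 1.
           step_cost \<sigma> n (W n \<epsilon>) (\<phi> \<epsilon>) \<le> C * real n ^ 2 * ((1 / \<epsilon>) * ln (1 / \<epsilon>)))"
proof -
  obtain c C where "c > 0" "C > 0" and bounds':
    "\<And>V \<epsilon> n W \<phi>. 1 \<le> n \<Longrightarrow> symmetric_zassenhaus V \<epsilon> n W \<Longrightarrow> 0 \<le> \<phi> \<Longrightarrow>
       c * real n ^ 2 * \<phi> \<le> step_cost \<sigma> n W \<phi> \<and> step_cost \<sigma> n W \<phi> \<le> C * real n ^ 2 * \<phi>"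
    using step_cost_quadratic_bounds[OF \<open>\<sigma> > 0\<close>] by metis
  have bounds: "c * real n ^ 2 * \<phi> \<epsilon> \<le> step_cost \<sigma> n (W n \<epsilon>) (\<phi> \<epsilon>)"
      "step_cost \<sigma> n (W n \<epsilon>) (\<phi> \<epsilon>) \<le> C * real n ^ 2 * \<phi> \<epsilon>"
    if "1 \<le> n" "0 < \<epsilon>" "\<epsilon> < 1" for n \<epsilon>
    using bounds'[OF that(1) assms(5)[OF that(2,3)] less_imp_le[OF assms(7)[OF that(2,3)]]]
    by blast+
  have "(\<lambda>n. step_cost \<sigma> n (W n \<epsilon>) (\<phi> \<epsilon>)) \<in> \<Theta>(\<lambda>n. real n ^ 2)" if \<epsilon>: "0 < \<epsilon>" "\<epsilon> < 1" for \<epsilon>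
  proof -
    \<comment> \<open>The Landau symbols compare norms, so nonnegativity is needed to drop
      them.\<close>
    have pos: "0 \<le> step_cost \<sigma> n (W n \<epsilon>) (\<phi> \<epsilon>)" for n
      using assms(7)[OF \<epsilon>] unfolding step_cost_def
      by (intro mult_nonneg_nonneg of_nat_0_le_iff less_imp_le)
    show ?thesis
    proof (rule bigthetaI)
      show "(\<lambda>n. step_cost \<sigma> n (W n \<epsilon>) (\<phi> \<epsilon>)) \<in> O(\<lambda>n. real n ^ 2)"
        using bounds(2)[OF _ \<epsilon>] pos
        by (intro bigoI[of _ "C * \<phi> \<epsilon>"] eventually_mono[OF eventually_ge_at_top[of 1]])
          (simp add: mult_ac)
      show "(\<lambda>n. step_cost \<sigma> n (W n \<epsilon>) (\<phi> \<epsilon>)) \<in> \<Omega>(\<lambda>n. real n ^ 2)"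
        using bounds(1)[OF _ \<epsilon>] pos \<open>c > 0\<close> assms(7)[OF \<epsilon>]
        by (intro landau_omega.bigI[of "c * \<phi> \<epsilon>"] eventually_mono[OF eventually_ge_at_top[of 1]])
          (simp_all add: mult_ac)
    qed
  qed
  moreover have "\<exists>c > 0. \<exists>C > 0. \<forall>n \<ge> 1. \<forall>\<epsilon>. 0 < \<epsilon> \<and> \<epsilon> < 1 \<longrightarrow>
           c * real n ^ 2 * \<phi> \<epsilon> \<le> step_cost \<sigma> n (W n \<epsilon>) (\<phi> \<epsilon>) \<and>
           step_cost \<sigma> n (W n \<epsilon>) (\<phi> \<epsilon>) \<le> C * real n ^ 2 * \<phi> \<epsilon>"
    using bounds \<open>c > 0\<close> \<open>C > 0\<close> by blast
  moreover have "\<exists>C > 0. \<forall>\<^sub>F \<epsilon> in at_right 0. \<forall>n \<ge> 1.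
           step_cost \<sigma> n (W n \<epsilon>) (\<phi> \<epsilon>) \<le> C * real n ^ 2 * ((1 / \<epsilon>) * ln (1 / \<epsilon>))"
  proof -
    obtain B where "B > 0" and B:
      "\<forall>\<^sub>F \<epsilon> in at_right 0. norm (\<phi> \<epsilon>) \<le> B * norm ((1 / \<epsilon>) * ln (1 / \<epsilon>))"
      using landau_o.bigE[OF assms(8)] by blast
    \<comment> \<open>For such \<open>\<epsilon>\<close> the logarithm of
      \<open>1 / \<epsilon>\<close> is positive, which removes the norm, and \<open>bounds\<close>
      applies.\<close>
    have "\<forall>\<^sub>F \<epsilon> in at_right (0::real). \<epsilon> \<in> {0<..<1}"
      by (rule eventually_at_right_real) simp
    with B have "\<forall>\<^sub>F \<epsilon> in at_right 0. \<forall>n \<ge> 1.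
           step_cost \<sigma> n (W n \<epsilon>) (\<phi> \<epsilon>) \<le> C * B * real n ^ 2 * ((1 / \<epsilon>) * ln (1 / \<epsilon>))"
    proof eventually_elim
      case (elim \<epsilon>)
      then have "\<phi> \<epsilon> \<le> B * ((1 / \<epsilon>) * ln (1 / \<epsilon>))"
        by (simp add: ln_div abs_mult)
      then have "C * real n ^ 2 * \<phi> \<epsilon> \<le> C * real n ^ 2 * (B * ((1 / \<epsilon>) * ln (1 / \<epsilon>)))" for n
        using \<open>C > 0\<close> by (intro mult_left_mono) auto
      also have "C * real n ^ 2 * (B * ((1 / \<epsilon>) * ln (1 / \<epsilon>)))
          = C * B * real n ^ 2 * ((1 / \<epsilon>) * ln (1 / \<epsilon>))" for n
        by (simp only: mult_ac)
      finally show ?case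
        using bounds(2) elim by (meson greaterThanLessThan_iff order.trans)
    qed
    then show ?thesis
      using \<open>B > 0\<close> \<open>C > 0\<close> by (intro exI[of _ "C * B"]) simp
  qed
  ultimately show ?thesis
    by blast
qed

end
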